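(* Let $S_1=(X_1,X_1,U_1,U_1,X_1,F_1,\mathrm{id})$ and $S_2=(X_2,X_2,U_2,U_2,X_2,F_2,\mathrm{id})$ be simple systems, let $\Sigma_1$ be a specification on $U_1\times X_1$ and $\Sigma_2$ a specification on $U_2\times X_2$, and let $Q\subseteq X_1\times X_2$. If $(S_1,\Sigma_1)\preccurlyeq_Q(S_2,\Sigma_2)$ and the system $C$ solves the control problem $(S_2,\Sigma_2)$, then $C\circ Q$ solves the control problem $(S_1,\Sigma_1)$.
   Context: Notation. $\mathbb{N}=\{1,2,\dots\}$, $\mathbb{Z}_+=\{0,1,2,\dots\}$. For $T\in\mathbb{Z}_+\cup\{\infty\}$, $[0;T[\,=\{t\in\mathbb{Z}_+: t<T\}$; $A^{[0;T[}$ is the set of maps $[0;T[\,\to A$, and $A^\infty=\bigcup_{T\in\mathbb{Z}_+\cup\{\infty\}}A^{[0;T[}$. $f\colon A\rightrightarrows B$ denotes a set-valued map, identified with the relation $\{(a,b): b\in f(a)\}\subseteq A\times B$; $f(M)=\bigcup_{a\in M}f(a)$ for $M\subseteq A$; $f$ is strict if $f(a)\neq\emptyset$ for all $a\in A$. Systems. A system is a septuple $S=(X,X_0,U,V,Y,F,H)$ where $X,X_0,U,V,Y$ are nonempty sets, $X_0\subseteq X$, $H\colon X\times U\rightrightarrows Y\times V$ is strict, and $F\colon X\times V\rightrightarrows X$. A solution of $S$ on $[0;T[$, $T\in\mathbb{N}\cup\{\infty\}$, is a quadruple $(u,v,x,y)\in U^{[0;T[}\times V^{[0;T[}\times X^{[0;T[}\times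 Y^{[0;T[}$ with $x(0)\in X_0$, $x(t+1)\in F(x(t),v(t))$ for all $t\in[0;T-1[$, and $(y(t),v(t))\in H(x(t),u(t))$ for all $t\in[0;T[$. $S$ is Moore if $(y,v)\in H(x,u)$ and $u'\in U$ imply that there is $v'$ with $(y,v')\in H(x,u')$. $S$ is simple if $U=V$, $X=Y$, $X_0=X$ and $H=\mathrm{id}$, i.e. $H(x,u)=\{(x,u)\}$. Behavior. $\mathcal{B}(S)$ is the set of pairs $(u,y)$ for which there exist $v,x,T$ such that $(u,v,x,y)$ is a solution of $S$ on $[0;T[$ and, if $T<\infty$, then $F(x(T-1),v(T-1))=\emptyset$. Serial composition with a quantizer. If $S=(X,X_0,U,V,Y,F,H)$ is a system, $U'$ a nonempty set and $Q\colon U'\rightrightarrows U$ is strict, then $S\circ Q=(X,X_0,U',V,Y,F,H')$ with $H'(x,u')=H(x,Q(u'))=\bigcup_{u\in Q(u')}H(x,u)$ (this also applies if $Q$ takes its values in a subset of $U$). Feedback composition. Let $S_i=(X_i,X_{i,0},U_i,V_i,Y_i,F_i,H_i)$, $i\in\{1,2\}$, be systems. $S_1$ is feedback composable with $S_2$ if $S_2$ is Moore, $Y_2\subseteq U_1$, $Y_1\subseteq U_2$, and: whenever $(y_2,v_2)\in H_2(x_2,y_1)$, $(y_1,v_1)\in H_1(x_1,y_2)$ and $F_2(x_2,v_2)=\emptyset$, then $F_1(x_1,v_1)=\emptyset$. In that case the closed loop is $S_1\times S_2=(X_1\times X_2,X_{1,0}\times X_{2,0},\{0\},V_1\times V_2,Y_1\times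 Y_2,F_{12},H_{12})$ with $F_{12}(x,v)=F_1(x_1,v_1)\times F_2(x_2,v_2)$ and $H_{12}(x,0)=\{(y,v): (y_1,v_1)\in H_1(x_1,y_2)\wedge(y_2,v_2)\in H_2(x_2,y_1)\}$. Since its input alphabet is $\{0\}$, elements $(0,(y_1,y_2))$ of the behavior of $S_1\times S_2$ are identified with $(y_1,y_2)$. Control problems. A specification on a set $Z$ is a subset $\Sigma\subseteq Z^\infty$ (pairs of maps with common domain are identified with maps into the product). Given a system $S$ with input alphabet $U$ and output alphabet $Y$ and a specification $\Sigma$ on $U\times Y$, a system $C$ solves the control problem $(S,\Sigma)$ if $C$ is feedback composable with $S$ and $\mathcal{B}(C\times S)\subseteq\Sigma$. Feedback refinement relation. For a simple system $S$ put $U_S(x)=\{u\in U: F(x,u)\neq\emptyset\}$. For simple systems $S_i=(X_i,X_i,U_i,U_i,X_i,F_i,\mathrm{id})$, $i\in\{1,2\}$, with $U_2\subseteq U_1$, a strict relation $Q\subseteq X_1\times X_2$ is a feedback refinement relation from $S_1$ to $S_2$, written $S_1\preccurlyeq_Q S_2$, if for all $(x_1,x_2)\in Q$: (1) $U_{S_2}(x_2)\subseteq U_{S_1}(x_1)$; (2) $u\in U_{S_2}(x_2)$ implies $Q(F_1(x_1,u))\subseteq F_2(x_2,u)$. Abstract specification. Let $S_i=(X_i,X_i,U_i,U_i,X_i,F_i,\mathrm{id})$, $i\in\{1,2\}$, be simple systems, $\Sigma_1$ a specification on $U_1\times X_1$, and $Q\subseteq X_1\times X_2$ strict. A specification $\Sigma_2$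 on $U_2\times X_2$ is an abstract specification associated with $S_1,S_2,Q,\Sigma_1$ if: whenever $(u,x_2)\in\Sigma_2$ is defined on $[0;T[$ for some $T\in\mathbb{N}\cup\{\infty\}$, and $x_1\colon[0;T[\,\to X_1$ satisfies $(x_1(t),x_2(t))\in Q$ for all $t\in[0;T[$, then $(u,x_1)\in\Sigma_1$. We write $(S_1,\Sigma_1)\preccurlyeq_Q(S_2,\Sigma_2)$ if $S_1\preccurlyeq_Q S_2$ and $\Sigma_2$ is an abstract specification associated with $S_1,S_2,Q,\Sigma_1$. *)

theory Defs
  imports Main "HOL-Library.Extended_Nat"
begin

text \<open>
  A set-valued map from \<open>A\<close> to \<open>B\<close> is a relation \<open>f \<subseteq> A \<times> B\<close>; its value at \<open>a\<close> is \<open>f `` {a}\<close>, and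
  the image of a set \<open>M\<close> is \<open>f `` M\<close>.
\<close>

definition strict_map :: "'a set \<Rightarrow> ('a \<times> 'b) set \<Rightarrow> bool" where
  "strict_map A f \<longleftrightarrow> (\<forall>a\<in>A. f `` {a} \<noteq> {})"

definition time_interval :: "enat \<Rightarrow> nat set" where
  "time_interval T = {t. enat t < T}"

text \<open>
  A signal on \<open>[0;T[\<close> is a partial map on \<open>nat\<close> with exactly this domain, so that a signal determines
  its \<open>T\<close>.
\<close>

definition signals :: "'a set \<Rightarrow> enat \<Rightarrow> (nat \<rightharpoonup> 'a) set" where
  "signals A T = {f. dom f = time_interval T \<and> ran f \<subseteq> A}"

definition all_signals :: "'a set \<Rightarrow> (nat \<rightharpoonup> 'a) set" where
  "all_signals A = (\<Union>T. signals A T)"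

definition pair_signal :: "(nat \<rightharpoonup> 'a) \<Rightarrow> (nat \<rightharpoonup> 'b) \<Rightarrow> (nat \<rightharpoonup> 'a \<times> 'b)" where
  "pair_signal f g = (\<lambda>t. if t \<in> dom f \<inter> dom g then Some (the (f t), the (g t)) else None)"

definition is_specification :: "'z set \<Rightarrow> (nat \<rightharpoonup> 'z) set \<Rightarrow> bool" where
  "is_specification Z \<Sigma> \<longleftrightarrow> \<Sigma> \<subseteq> all_signals Z"


text \<open>The fields are, in this order, the components \<open>X, X\<^sub>0, U, V, Y, F, H\<close> of a septuple.\<close>

record ('x, 'u, 'v, 'y) system =
  states    :: "'x set"
  initials  :: "'x set"
  inputs    :: "'u set"
  internals :: "'v set"
  outputs   :: "'y set"
  trans_map :: "(('x \<times> 'v) \<times> 'x) set"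
  out_map   :: "(('x \<times> 'u) \<times> ('y \<times> 'v)) set"

definition is_system :: "('x, 'u, 'v, 'y) system \<Rightarrow> bool" where
  "is_system S \<longleftrightarrow>
     states S \<noteq> {} \<and> initials S \<noteq> {} \<and> inputs S \<noteq> {} \<and> internals S \<noteq> {} \<and> outputs S \<noteq> {} \<and>
     initials S \<subseteq> states S \<and>
     trans_map S \<subseteq> (states S \<times> internals S) \<times> states S \<and>
     out_map S \<subseteq> (states S \<times> inputs S) \<times> (outputs S \<times> internals S) \<and>
     strict_map (states S \<times> inputs S) (out_map S)"

definition solution ::
  "('x, 'u, 'v, 'y) system \<Rightarrow> enat \<Rightarrow>
   (nat \<rightharpoonup> 'u) \<Rightarrow> (nat \<rightharpoonup> 'v) \<Rightarrow> (nat \<rightharpoonup> 'x) \<Rightarrow> (nat \<rightharpoonup> 'y) \<Rightarrow> bool" where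
  "solution S T u v x y \<longleftrightarrow>
     T \<ge> 1 \<and>
     u \<in> signals (inputs S) T \<and> v \<in> signals (internals S) T \<and>
     x \<in> signals (states S) T \<and> y \<in> signals (outputs S) T \<and>
     the (x 0) \<in> initials S \<and>
     (\<forall>t \<in> time_interval (T - 1). the (x (t + 1)) \<in> trans_map S `` {(the (x t), the (v t))}) \<and>
     (\<forall>t \<in> time_interval T. (the (y t), the (v t)) \<in> out_map S `` {(the (x t), the (u t))})"

definition behavior :: "('x, 'u, 'v, 'y) system \<Rightarrow> ((nat \<rightharpoonup> 'u) \<times> (nat \<rightharpoonup> 'y)) set" where
  "behavior S = {(u, y). \<exists>v x T. solution S T u v x y \<and>
     (\<forall>n. T = enat n \<longrightarrow> trans_map S `` {(the (x (n - 1)), the (v (n - 1)))} = {})}"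

definition moore_system :: "('x, 'u, 'v, 'y) system \<Rightarrow> bool" where
  "moore_system S \<longleftrightarrow> is_system S \<and>
     (\<forall>x u y v u'. (y, v) \<in> out_map S `` {(x, u)} \<and> u' \<in> inputs S \<longrightarrow>
        (\<exists>v'. (y, v') \<in> out_map S `` {(x, u')}))"

definition simple_system :: "('x, 'u, 'u, 'x) system \<Rightarrow> bool" where
  "simple_system S \<longleftrightarrow> is_system S \<and>
     inputs S = internals S \<and> states S = outputs S \<and> initials S = states S \<and>
     out_map S = Id_on (states S \<times> inputs S)"


text \<open>
  The composition of \<open>S\<close> with the quantizer \<open>Q\<close>. The new input alphabet \<open>U'\<close> is an explicit
  argument; the composition is meant for \<open>Q \<subseteq> U' \<times> inputs S\<close> strict on \<open>U'\<close>.
\<close>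

definition serial_comp ::
  "('x, 'u, 'v, 'y) system \<Rightarrow> 'w set \<Rightarrow> ('w \<times> 'u) set \<Rightarrow> ('x, 'w, 'v, 'y) system" where
  "serial_comp S U' Q =
     \<lparr>states = states S, initials = initials S, inputs = U', internals = internals S,
      outputs = outputs S, trans_map = trans_map S,
      out_map = {((x, u'), yv). u' \<in> U' \<and> yv \<in> out_map S `` ({x} \<times> (Q `` {u'}))}\<rparr>"

definition feedback_composable ::
  "('x1, 'y2, 'v1, 'y1) system \<Rightarrow> ('x2, 'y1, 'v2, 'y2) system \<Rightarrow> bool" where
  "feedback_composable S1 S2 \<longleftrightarrow>
     is_system S1 \<and> is_system S2 \<and> moore_system S2 \<and>
     outputs S2 \<subseteq> inputs S1 \<and> outputs S1 \<subseteq> inputs S2 \<and>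
     (\<forall>x1 x2 y1 y2 v1 v2.
        (y2, v2) \<in> out_map S2 `` {(x2, y1)} \<and> (y1, v1) \<in> out_map S1 `` {(x1, y2)} \<and>
        trans_map S2 `` {(x2, v2)} = {} \<longrightarrow> trans_map S1 `` {(x1, v1)} = {})"

definition closed_loop ::
  "('x1, 'y2, 'v1, 'y1) system \<Rightarrow> ('x2, 'y1, 'v2, 'y2) system \<Rightarrow>
   ('x1 \<times> 'x2, nat, 'v1 \<times> 'v2, 'y1 \<times> 'y2) system" where
  "closed_loop S1 S2 =
     \<lparr>states = states S1 \<times> states S2, initials = initials S1 \<times> initials S2, inputs = {0},
      internals = internals S1 \<times> internals S2, outputs = outputs S1 \<times> outputs S2,
      trans_map = {(((x1, x2), (v1, v2)), (x1', x2')).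
         x1' \<in> trans_map S1 `` {(x1, v1)} \<and> x2' \<in> trans_map S2 `` {(x2, v2)}},
      out_map = {(((x1, x2), u), ((y1, y2), (v1, v2))).
         u = 0 \<and> (y1, v1) \<in> out_map S1 `` {(x1, y2)} \<and> (y2, v2) \<in> out_map S2 `` {(x2, y1)}}\<rparr>"

text \<open>
  The input component of the behavior of a closed loop is constantly \<open>0\<close>; dropping it with \<open>snd\<close>
  gives signals with values in \<open>outputs C \<times> outputs S\<close>, i.e. in \<open>inputs S \<times> outputs S\<close>.
\<close>

definition solves_control_problem ::
  "('c, 'y, 'v, 'u) system \<Rightarrow> ('x, 'u, 'w, 'y) system \<Rightarrow> (nat \<rightharpoonup> 'u \<times> 'y) set \<Rightarrow> bool" where
  "solves_control_problem C S \<Sigma> \<longleftrightarrow>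
     is_system C \<and> is_system S \<and> is_specification (inputs S \<times> outputs S) \<Sigma> \<and>
     feedback_composable C S \<and> snd ` behavior (closed_loop C S) \<subseteq> \<Sigma>"

definition enabled_inputs :: "('x, 'u, 'u, 'x) system \<Rightarrow> 'x \<Rightarrow> 'u set" where
  "enabled_inputs S x = {u \<in> inputs S. trans_map S `` {(x, u)} \<noteq> {}}"

definition feedback_refinement ::
  "('x1, 'u, 'u, 'x1) system \<Rightarrow> ('x1 \<times> 'x2) set \<Rightarrow> ('x2, 'u, 'u, 'x2) system \<Rightarrow> bool" where
  "feedback_refinement S1 Q S2 \<longleftrightarrow>
     simple_system S1 \<and> simple_system S2 \<and> inputs S2 \<subseteq> inputs S1 \<and>
     Q \<subseteq> states S1 \<times> states S2 \<and> strict_map (states S1) Q \<and>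
     (\<forall>(x1, x2) \<in> Q.
        enabled_inputs S2 x2 \<subseteq> enabled_inputs S1 x1 \<and>
        (\<forall>u \<in> enabled_inputs S2 x2.
           Q `` (trans_map S1 `` {(x1, u)}) \<subseteq> trans_map S2 `` {(x2, u)}))"

definition abstract_specification ::
  "('x1, 'u, 'u, 'x1) system \<Rightarrow> ('x2, 'u, 'u, 'x2) system \<Rightarrow> ('x1 \<times> 'x2) set \<Rightarrow>
   (nat \<rightharpoonup> 'u \<times> 'x1) set \<Rightarrow> (nat \<rightharpoonup> 'u \<times> 'x2) set \<Rightarrow> bool" where
  "abstract_specification S1 S2 Q \<Sigma>1 \<Sigma>2 \<longleftrightarrow>
     simple_system S1 \<and> simple_system S2 \<and>
     Q \<subseteq> states S1 \<times> states S2 \<and> strict_map (states S1) Q \<and>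
     is_specification (inputs S1 \<times> states S1) \<Sigma>1 \<and> is_specification (inputs S2 \<times> states S2) \<Sigma>2 \<and>
     (\<forall>T \<ge> 1. \<forall>u \<in> signals (inputs S2) T. \<forall>x2 \<in> signals (states S2) T. \<forall>x1 \<in> signals (states S1) T.
        pair_signal u x2 \<in> \<Sigma>2 \<and> (\<forall>t \<in> time_interval T. (the (x1 t), the (x2 t)) \<in> Q) \<longrightarrow>
        pair_signal u x1 \<in> \<Sigma>1)"

definition control_refinement ::
  "('x1, 'u, 'u, 'x1) system \<Rightarrow> (nat \<rightharpoonup> 'u \<times> 'x1) set \<Rightarrow> ('x1 \<times> 'x2) set \<Rightarrow>
   ('x2, 'u, 'u, 'x2) system \<Rightarrow> (nat \<rightharpoonup> 'u \<times> 'x2) set \<Rightarrow> bool" where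
  "control_refinement S1 \<Sigma>1 Q S2 \<Sigma>2 \<longleftrightarrow>
     feedback_refinement S1 Q S2 \<and> abstract_specification S1 S2 Q \<Sigma>1 \<Sigma>2"

end

theory Submission
  imports Defs
begin

text \<open>
  Fix a closed-loop run of \<open>C \<circ> Q\<close> with \<open>S1\<close>. Since \<open>S1\<close> is simple, its output is its state \<open>x1\<close> and
  its internal variable is the control \<open>u\<close>. At each time \<open>t\<close> the quantizer hands \<open>C\<close> some
  \<open>q t \<in> Q `` {x1 t}\<close>; recording these choices gives an abstract signal \<open>q\<close>. The claim is that
  replacing \<open>x1\<close> by \<open>q\<close> and leaving the controller state and the control alone produces a run of
  \<open>C\<close> in closed loop with \<open>S2\<close> (\<open>closed_loop_run_abstract\<close>).

  The one thing to check is that \<open>q\<close> follows the transitions of \<open>S2\<close>. The second condition on a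
  feedback refinement relation gives this only for controls enabled in \<open>S2\<close> at \<open>q t\<close>, and
  enabledness is what the blocking condition in the definition of feedback composability provides:
  were \<open>S2\<close> blocked, \<open>C\<close> would be blocked as well, yet the run continues.

  Maximality of finite runs is preserved since blocking passes from \<open>S1\<close> to \<open>S2\<close>
  (\<open>feedback_refinement_blocking\<close>), and this same fact makes \<open>C \<circ> Q\<close> feedback composable with
  \<open>S1\<close>. So the abstract run lies in the behavior of the closed loop of \<open>C\<close> and \<open>S2\<close>, hence in
  \<open>\<Sigma>2\<close>, and \<open>q\<close> is pointwise \<open>Q\<close>-related to \<open>x1\<close>; the definition of an abstract specification then
  puts the concrete run in \<open>\<Sigma>1\<close>.
\<close>

section \<open>Signals in normal form\<close>

text \<open>
  Every signal on \<open>[0;T[\<close> has this form, so a run can be described by total functions of time and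
  \<open>T\<close>, and pairing of signals becomes pointwise pairing.
\<close>

definition sampled :: "enat \<Rightarrow> (nat \<Rightarrow> 'a) \<Rightarrow> (nat \<rightharpoonup> 'a)" where
  "sampled T f = (\<lambda>t. if t \<in> time_interval T then Some (f t) else None)"

lemma the_sampled [simp]: "t \<in> time_interval T \<Longrightarrow> the (sampled T f t) = f t"
  by (simp add: sampled_def)

lemma sampled_in_signals:
  "(\<And>t. t \<in> time_interval T \<Longrightarrow> f t \<in> A) \<Longrightarrow> sampled T f \<in> signals A T"
  by (auto simp: sampled_def signals_def dom_def ran_def split: if_splits)

lemma pair_signal_sampled:
  "pair_signal (sampled T f) (sampled T g) = sampled T (\<lambda>t. (f t, g t))"
  by (auto simp: sampled_def pair_signal_def dom_def)

lemma signal_eq_sampled: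
  assumes "f \<in> signals A T" and "\<And>t. t \<in> time_interval T \<Longrightarrow> the (f t) = g t"
  shows "f = sampled T g"
proof
  fix t
  have "t \<in> dom f \<longleftrightarrow> t \<in> time_interval T"
    using assms(1) by (simp add: signals_def)
  then show "f t = sampled T g t"
    using assms(2)[of t] by (force simp: sampled_def domIff)
qed

lemma zero_in_time_interval: "1 \<le> T \<Longrightarrow> 0 \<in> time_interval T"
  by (cases T) (auto simp: time_interval_def one_enat_def zero_enat_def)

lemma last_in_time_interval: "1 \<le> enat n \<Longrightarrow> n - 1 \<in> time_interval (enat n)"
  by (auto simp: time_interval_def one_enat_def)

lemma time_interval_pred:
  "t \<in> time_interval (T - 1) \<Longrightarrow> t \<in> time_interval T \<and> Suc t \<in> time_interval T"
  by (cases T) (auto simp: time_interval_def one_enat_def)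

section \<open>Simple systems and quantized controllers\<close>

lemma simple_system_out_map:
  assumes "simple_system S"
  shows "((x, u), (y, v)) \<in> out_map S \<longleftrightarrow> x \<in> states S \<and> u \<in> inputs S \<and> y = x \<and> v = u"
  using assms by (auto simp: simple_system_def)

lemma simple_system_moore:
  assumes "simple_system S"
  shows "moore_system S"
  using assms by (auto simp: moore_system_def simple_system_out_map) (simp add: simple_system_def)

lemma serial_comp_out_map:
  "((x, w), yv) \<in> out_map (serial_comp S W Q) \<longleftrightarrow>
     w \<in> W \<and> (\<exists>q. (w, q) \<in> Q \<and> ((x, q), yv) \<in> out_map S)"
  by (auto simp: serial_comp_def)

lemma serial_comp_is_system:
  assumes sys: "is_system S" and ne: "W \<noteq> {}"
    and sub: "Q \<subseteq> W \<times> inputs S" and strict: "strict_map W Q"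
  shows "is_system (serial_comp S W Q)"
proof -
  let ?P = "serial_comp S W Q"
  have "strict_map (states S \<times> W) (out_map ?P)"
    unfolding strict_map_def
  proof
    fix a assume "a \<in> states S \<times> W"
    then obtain x w where a: "a = (x, w)" "x \<in> states S" "w \<in> W" by auto
    then obtain q where q: "(w, q) \<in> Q"
      using strict by (auto simp: strict_map_def)
    then obtain yv where "((x, q), yv) \<in> out_map S"
      using sys sub a unfolding is_system_def strict_map_def by fast
    then show "out_map ?P `` {a} \<noteq> {}"
      using a q serial_comp_out_map[of x w yv S W Q] by blast
  qed
  moreover have "out_map ?P \<subseteq> (states S \<times> W) \<times> (outputs S \<times> internals S)"
  proof
    fix p assume "p \<in> out_map ?P"
    then obtain x w yv where p: "p = ((x, w), yv)" "((x, w), yv) \<in> out_map ?P"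
      by (metis surj_pair)
    then obtain q where "w \<in> W" "((x, q), yv) \<in> out_map S"
      using serial_comp_out_map[of x w yv S W Q] by blast
    then show "p \<in> (states S \<times> W) \<times> (outputs S \<times> internals S)"
      using sys p unfolding is_system_def by blast
  qed
  ultimately show ?thesis
    using sys ne unfolding is_system_def by (simp add: serial_comp_def)
qed

text \<open>
  This is the first refinement condition, contraposed. Both composability of the refined controller
  and maximality of the abstract run need it in this form.
\<close>

lemma feedback_refinement_blocking:
  assumes "feedback_refinement S1 Q S2" and "(x1, x2) \<in> Q" and "u \<in> inputs S2"
    and "trans_map S1 `` {(x1, u)} = {}"
  shows "trans_map S2 `` {(x2, u)} = {}"
proof (rule ccontr)
  assume "trans_map S2 `` {(x2, u)} \<noteq> {}"
  then have "u \<in> enabled_inputs S2 x2"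
    using assms(3) by (simp add: enabled_inputs_def)
  then have "u \<in> enabled_inputs S1 x1"
    using assms(1,2) by (auto simp: feedback_refinement_def)
  then show False
    using assms(4) by (simp add: enabled_inputs_def)
qed

lemma feedback_refinement_step:
  assumes "feedback_refinement S1 Q S2" and "(x1, x2) \<in> Q" and "u \<in> inputs S2"
    and "trans_map S2 `` {(x2, u)} \<noteq> {}"
    and "((x1, u), x1') \<in> trans_map S1" and "(x1', x2') \<in> Q"
  shows "((x2, u), x2') \<in> trans_map S2"
proof -
  have "u \<in> enabled_inputs S2 x2"
    using assms(3,4) by (simp add: enabled_inputs_def)
  then have "Q `` (trans_map S1 `` {(x1, u)}) \<subseteq> trans_map S2 `` {(x2, u)}"
    using assms(1,2) unfolding feedback_refinement_def by fast
  then show ?thesis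
    using assms(5,6) by blast
qed

text \<open>
  For a simple plant the blocking condition can be stated without output and internal variable of
  the plant, since \<open>H\<close> is the identity.
\<close>

lemma composable_simple_blocking:
  assumes "feedback_composable C S" and "simple_system S"
    and "((c, x), (u, v)) \<in> out_map C" and "x \<in> states S" and "u \<in> inputs S"
    and "trans_map S `` {(x, u)} = {}"
  shows "trans_map C `` {(c, v)} = {}"
proof -
  have "(x, u) \<in> out_map S `` {(x, u)}"
    using assms simple_system_out_map by fastforce
  then show ?thesis
    using assms(1,3,6) unfolding feedback_composable_def by blast
qed

lemma serial_comp_composable:
  assumes comp: "feedback_composable C S2" and ref: "feedback_refinement S1 Q S2"
  shows "feedback_composable (serial_comp C (states S1) Q) S1"
proof -
  let ?P = "serial_comp C (states S1) Q"
  have simple: "simple_system S1" "simple_system S2" and "inputs S2 \<subseteq> inputs S1"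
    and Q: "Q \<subseteq> states S1 \<times> states S2" "strict_map (states S1) Q"
    using ref by (auto simp: feedback_refinement_def)
  have sys: "is_system C" "is_system S1" and "states S1 \<noteq> {}" and "outputs S1 = states S1"
    and "outputs S2 = states S2"
    and C: "outputs S2 \<subseteq> inputs C" "outputs C \<subseteq> inputs S2"
    using comp simple by (auto simp: feedback_composable_def simple_system_def is_system_def)
  have "is_system ?P"
    by (rule serial_comp_is_system) (use sys Q C \<open>states S1 \<noteq> {}\<close> \<open>outputs S2 = states S2\<close> in auto)
  moreover have "trans_map ?P `` {(c, v1)} = {}"
    if out1: "(y1, v2) \<in> out_map S1 `` {(x1, u)}" and outP: "(u, v1) \<in> out_map ?P `` {(c, y1)}"
      and blocked: "trans_map S1 `` {(x1, v2)} = {}"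
    for c x1 u y1 v1 v2
  proof -
    have eq: "y1 = x1" "v2 = u"
      using out1 simple_system_out_map[OF simple(1)] by auto
    obtain q where q: "(x1, q) \<in> Q" "((c, q), (u, v1)) \<in> out_map C"
      using outP eq serial_comp_out_map[of c y1 "(u, v1)" C "states S1" Q] by auto
    have u: "u \<in> inputs S2"
      using q(2) sys(1) C(2) unfolding is_system_def by blast
    have "trans_map S2 `` {(q, u)} = {}"
      using feedback_refinement_blocking[OF ref q(1) u] blocked eq by simp
    then have "trans_map C `` {(c, v1)} = {}"
      using composable_simple_blocking[OF comp simple(2) q(2) _ u] q(1) Q(1) by blast
    then show ?thesis
      by (simp add: serial_comp_def)
  qed
  moreover have "outputs S1 \<subseteq> inputs ?P" "outputs ?P \<subseteq> inputs S1"
    using \<open>outputs S1 = states S1\<close> C(2) \<open>inputs S2 \<subseteq> inputs S1\<close> by (auto simp: serial_comp_def)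
  ultimately show ?thesis
    using sys(2) simple_system_moore[OF simple(1)] unfolding feedback_composable_def by blast
qed

section \<open>Runs of the closed loop\<close>

lemma closed_loop_simps:
  "states (closed_loop A B) = states A \<times> states B"
  "initials (closed_loop A B) = initials A \<times> initials B"
  "inputs (closed_loop A B) = {0}"
  "internals (closed_loop A B) = internals A \<times> internals B"
  "outputs (closed_loop A B) = outputs A \<times> outputs B"
  by (simp_all add: closed_loop_def)

lemma closed_loop_trans_map:
  "trans_map (closed_loop A B) `` {(x, v)} =
     (trans_map A `` {(fst x, fst v)}) \<times> (trans_map B `` {(snd x, snd v)})"
  by (cases x; cases v) (auto simp: closed_loop_def)

lemma closed_loop_out_map:
  "(y, v) \<in> out_map (closed_loop A B) `` {(x, u)} \<longleftrightarrow> u = 0 \<and>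
     ((fst x, snd y), (fst y, fst v)) \<in> out_map A \<and>
     ((snd x, fst y), (snd y, snd v)) \<in> out_map B"
  by (cases x; cases y; cases v) (auto simp: closed_loop_def)

text \<open>
  The simulation argument: the abstract closed loop is driven through the same controller states,
  the same internal signal and the same controls, with the quantizer's choices \<open>q\<close> as plant
  states.
\<close>

lemma closed_loop_run_abstract:
  assumes comp: "feedback_composable C S2" and ref: "feedback_refinement S1 Q S2"
    and run: "(w, y) \<in> behavior (closed_loop (serial_comp C (states S1) Q) S1)"
  obtains T u x1 q where "1 \<le> T" and "y = sampled T (\<lambda>t. (u t, x1 t))"
    and "\<forall>t \<in> time_interval T. u t \<in> inputs S2 \<and> (x1 t, q t) \<in> Q"
    and "(w, sampled T (\<lambda>t. (u t, q t))) \<in> behavior (closed_loop C S2)"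
proof -
  let ?P = "serial_comp C (states S1) Q"
  have simple: "simple_system S1" "simple_system S2"
    and Q: "Q \<subseteq> states S1 \<times> states S2"
    using ref by (auto simp: feedback_refinement_def)
  have sysC: "is_system C" and C: "outputs C \<subseteq> inputs S2"
    using comp by (auto simp: feedback_composable_def)
  have S2: "initials S2 = states S2" "outputs S2 = states S2" "internals S2 = inputs S2"
    using simple(2) by (auto simp: simple_system_def)
  obtain v x T where sol: "solution (closed_loop ?P S1) T w v x y"
    and fin: "\<And>n. T = enat n \<Longrightarrow>
      trans_map (closed_loop ?P S1) `` {(the (x (n - 1)), the (v (n - 1)))} = {}"
    using run by (auto simp: behavior_def)
  define c x1 u vc where "c t = fst (the (x t))" and "x1 t = snd (the (x t))"
    and "u t = fst (the (y t))" and "vc t = fst (the (v t))" for t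
  note defs = c_def x1_def u_def vc_def
  have T: "1 \<le> T" and wsig: "w \<in> signals {0} T" and vsig: "v \<in> signals (internals (closed_loop ?P S1)) T"
    and xsig: "x \<in> signals (states (closed_loop ?P S1)) T"
    and ysig: "y \<in> signals (outputs (closed_loop ?P S1)) T"
    and init: "the (x 0) \<in> initials (closed_loop ?P S1)"
    using sol by (auto simp: solution_def closed_loop_simps)
  have step: "((c t, vc t), c (Suc t)) \<in> trans_map C"
    "((x1 t, snd (the (v t))), x1 (Suc t)) \<in> trans_map S1"
    if "t \<in> time_interval (T - 1)" for t
  proof -
    have "the (x (Suc t)) \<in> trans_map (closed_loop ?P S1) `` {(the (x t), the (v t))}"
      using sol that by (simp add: solution_def)
    then show "((c t, vc t), c (Suc t)) \<in> trans_map C"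
      "((x1 t, snd (the (v t))), x1 (Suc t)) \<in> trans_map S1"
      unfolding closed_loop_trans_map mem_Times_iff by (simp_all add: defs serial_comp_def)
  qed
  have out: "the (w t) = 0" "((c t, snd (the (y t))), (u t, vc t)) \<in> out_map ?P"
    "snd (the (y t)) = x1 t" "snd (the (v t)) = u t"
    if "t \<in> time_interval T" for t
  proof -
    have "(the (y t), the (v t)) \<in> out_map (closed_loop ?P S1) `` {(the (x t), the (w t))}"
      using sol that by (simp add: solution_def)
    then show "the (w t) = 0" "((c t, snd (the (y t))), (u t, vc t)) \<in> out_map ?P"
      "snd (the (y t)) = x1 t" "snd (the (v t)) = u t"
      unfolding closed_loop_out_map simple_system_out_map[OF simple(1)] by (auto simp: defs)
  qed
  have "\<exists>q. (x1 t, q) \<in> Q \<and> ((c t, q), (u t, vc t)) \<in> out_map C" if "t \<in> time_interval T" for t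
    using out(2,3)[OF that] unfolding serial_comp_out_map by auto
  then obtain q where q: "\<And>t. t \<in> time_interval T \<Longrightarrow> (x1 t, q t) \<in> Q"
    and outC: "\<And>t. t \<in> time_interval T \<Longrightarrow> ((c t, q t), (u t, vc t)) \<in> out_map C"
    by metis
  have mem: "c t \<in> states C" "vc t \<in> internals C" "u t \<in> outputs C" "u t \<in> inputs S2"
    "q t \<in> states S2" if "t \<in> time_interval T" for t
    using outC[OF that] q[OF that] sysC C Q unfolding is_system_def by blast+
  have y: "y = sampled T (\<lambda>t. (u t, x1 t))"
    by (rule signal_eq_sampled[OF ysig]) (simp add: prod_eq_iff out(3) u_def)
  have v: "v = sampled T (\<lambda>t. (vc t, u t))"
    by (rule signal_eq_sampled[OF vsig]) (simp add: prod_eq_iff out(4) vc_def)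
  have stepS2: "((q t, u t), q (Suc t)) \<in> trans_map S2" if t: "t \<in> time_interval (T - 1)" for t
  proof -
    have t': "t \<in> time_interval T" "Suc t \<in> time_interval T"
      using time_interval_pred[OF t] by auto
    \<comment> \<open>The controller moves at time \<open>t\<close>, so it is not blocked; by composability neither is \<open>S2\<close>.\<close>
    have "trans_map S2 `` {(q t, u t)} \<noteq> {}"
      using composable_simple_blocking[OF comp simple(2) outC[OF t'(1)] mem(5,4)[OF t'(1)]]
        step(1)[OF t] by blast
    moreover have "((x1 t, u t), x1 (Suc t)) \<in> trans_map S1"
      using step(2)[OF t] out(4)[OF t'(1)] by simp
    ultimately show ?thesis
      using feedback_refinement_step[OF ref q[OF t'(1)] mem(4)[OF t'(1)]] q[OF t'(2)] by blast
  qed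
  let ?x = "sampled T (\<lambda>t. (c t, q t))" and ?y = "sampled T (\<lambda>t. (u t, q t))"
  have "solution (closed_loop C S2) T w v ?x ?y"
    unfolding solution_def
  proof (intro conjI ballI)
    show "1 \<le> T" by (fact T)
    show "w \<in> signals (inputs (closed_loop C S2)) T"
      using wsig by (simp add: closed_loop_simps)
    show "v \<in> signals (internals (closed_loop C S2)) T"
      "?x \<in> signals (states (closed_loop C S2)) T" "?y \<in> signals (outputs (closed_loop C S2)) T"
      unfolding v closed_loop_simps by (auto intro!: sampled_in_signals simp: mem S2)
    show "the (?x 0) \<in> initials (closed_loop C S2)"
      using init mem(5) zero_in_time_interval[OF T]
      by (auto simp: closed_loop_simps S2 c_def serial_comp_def)
  next
    fix t assume t: "t \<in> time_interval (T - 1)"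
    then show "the (?x (t + 1)) \<in> trans_map (closed_loop C S2) `` {(the (?x t), the (v t))}"
      using time_interval_pred[OF t] step(1) stepS2 by (simp add: closed_loop_trans_map v)
  next
    fix t assume t: "t \<in> time_interval T"
    then show "(the (?y t), the (v t)) \<in> out_map (closed_loop C S2) `` {(the (?x t), the (w t))}"
      unfolding closed_loop_out_map simple_system_out_map[OF simple(2)]
      using out(1) outC mem by (simp add: v)
  qed
  moreover have "trans_map (closed_loop C S2) `` {(the (?x (n - 1)), the (v (n - 1)))} = {}"
    if n: "T = enat n" for n
  proof -
    let ?t = "n - 1"
    have t: "?t \<in> time_interval T"
      using T last_in_time_interval n by simp
    have "trans_map C `` {(c ?t, vc ?t)} = {} \<or> trans_map S1 `` {(x1 ?t, u ?t)} = {}"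
      using fin[OF n] out(4)[OF t] unfolding closed_loop_trans_map Times_empty
      by (simp add: defs serial_comp_def)
    then have "trans_map C `` {(c ?t, vc ?t)} = {} \<or> trans_map S2 `` {(q ?t, u ?t)} = {}"
      using feedback_refinement_blocking[OF ref q[OF t] mem(4)[OF t]] by blast
    then show ?thesis
      unfolding closed_loop_trans_map Times_empty using t by (simp add: v)
  qed
  ultimately have "(w, ?y) \<in> behavior (closed_loop C S2)"
    unfolding behavior_def by blast
  then show ?thesis
    using that T y q mem(4) by blast
qed

section \<open>Refinement of the controller\<close>

theorem mainTheorem3:
  fixes S1 :: "('x1, 'u, 'u, 'x1) system"
    and S2 :: "('x2, 'u, 'u, 'x2) system"
    and C :: "('c, 'x2, 'v, 'u) system"
    and \<Sigma>1 :: "(nat \<rightharpoonup> 'u \<times> 'x1) set"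
    and \<Sigma>2 :: "(nat \<rightharpoonup> 'u \<times> 'x2) set"
    and Q :: "('x1 \<times> 'x2) set"
  assumes "simple_system S1" and "simple_system S2"
    and "is_specification (inputs S1 \<times> states S1) \<Sigma>1"
    and "is_specification (inputs S2 \<times> states S2) \<Sigma>2"
    and "Q \<subseteq> states S1 \<times> states S2"
    and "control_refinement S1 \<Sigma>1 Q S2 \<Sigma>2"
    and "is_system C"
    and "solves_control_problem C S2 \<Sigma>2"
  shows "solves_control_problem (serial_comp C (states S1) Q) S1 \<Sigma>1"
proof -
  let ?P = "serial_comp C (states S1) Q"
  have ref: "feedback_refinement S1 Q S2" and abs: "abstract_specification S1 S2 Q \<Sigma>1 \<Sigma>2"
    using assms(6) by (auto simp: control_refinement_def)
  have comp: "feedback_composable C S2" and beh: "snd ` behavior (closed_loop C S2) \<subseteq> \<Sigma>2"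
    using assms(8) by (auto simp: solves_control_problem_def)
  have compP: "feedback_composable ?P S1"
    by (rule serial_comp_composable[OF comp ref])
  have "y \<in> \<Sigma>1" if run: "(w, y) \<in> behavior (closed_loop ?P S1)" for w y
  proof -
    obtain T u x1 q where T: "1 \<le> T" and y: "y = sampled T (\<lambda>t. (u t, x1 t))"
      and rel: "\<forall>t \<in> time_interval T. u t \<in> inputs S2 \<and> (x1 t, q t) \<in> Q"
      and "(w, sampled T (\<lambda>t. (u t, q t))) \<in> behavior (closed_loop C S2)"
      by (rule closed_loop_run_abstract[OF comp ref run])
    then have "sampled T (\<lambda>t. (u t, q t)) \<in> \<Sigma>2"
      using beh by force
    then have "pair_signal (sampled T u) (sampled T q) \<in> \<Sigma>2"
      by (simp add: pair_signal_sampled)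
    moreover have "sampled T u \<in> signals (inputs S2) T" "sampled T q \<in> signals (states S2) T"
      "sampled T x1 \<in> signals (states S1) T"
      using rel assms(5) by (auto intro!: sampled_in_signals)
    moreover have "\<forall>t \<in> time_interval T. (the (sampled T x1 t), the (sampled T q t)) \<in> Q"
      using rel by simp
    ultimately have "pair_signal (sampled T u) (sampled T x1) \<in> \<Sigma>1"
      using abs T unfolding abstract_specification_def by blast
    then show ?thesis
      by (simp add: y pair_signal_sampled)
  qed
  moreover have "outputs S1 = states S1"
    using assms(1) by (simp add: simple_system_def)
  ultimately show ?thesis
    using compP assms(3) unfolding solves_control_problem_def feedback_composable_def by auto
qed

end
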